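(* Let $d\ge 2$ and let $\Omega\subset\mathbb{R}^d$ be compact. Let $X_1,X_2,\ldots$ be i.i.d. points in $\Omega$ with density $\varphi_P$ and $Y_1,Y_2,\ldots$ i.i.d. points in $\Omega$ with density $\varphi_D$, all independent. For each $n$, let $L^*(n)$ be the length of an optimal stacker crane tour through the pairs $(X_i,Y_i)$, $i=1,\ldots,n$, and let $L_{\mathrm{SPLICE}}(n)$ be the length of the stacker crane tour produced by the SPLICE algorithm on these pairs. Then $$\lim_{n\to\infty}\frac{L_{\mathrm{SPLICE}}(n)}{L^*(n)}=1\quad\text{almost surely.}$$
   Context: Given pickup/delivery pairs $(x_i,y_i)$, $i=1,\ldots,n$, a stacker crane tour is a closed tour through all the points $x_1,\ldots,x_n,y_1,\ldots,y_n$ in which each pickup $x_i$ is immediately followed by its delivery $y_i$; its length is the sum of the Euclidean distances along the tour. The SPLICE algorithm: (1) compute a permutation $\sigma$ of $\{1,\ldots,n\}$ minimizing $\sum_i\|x_{\sigma(i)}-y_i\|$ (optimal bipartite matching); (2) add links $x_i\to y_i$ and $y_i\to x_{\sigma(i)}$, forming $N$ disjoint directed subtours; (3) if $N>1$, order the subtours $\mathcal{S}_1,\ldots,\mathcal{S}_N$ arbitrarily, set base = prev = the index of an arbitrary delivery in $\mathcal{S}_1$, and for $k=1,\ldots,N-1$: remove link $y_{\mathrm{prev}}\to x_{\sigma(\mathrm{prev})}$, let next be the index of the pickup in $\mathcal{S}_{k+1}$ closest to $y_{\mathrm{prev}}$, add link $y_{\mathrm{prev}}\to x_{\mathrm{next}}$,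 and set prev $=\sigma^{-1}(\mathrm{next})$; finally add link $y_{\mathrm{prev}}\to x_{\sigma(\mathrm{base})}$. The densities are densities of absolutely continuous distributions. *)

theory Defs
  imports "HOL-Probability.Probability" "HOL-Combinatorics.Permutations"
begin

text \<open>Pairs are indexed by 0..n-1: pickups x i, deliveries y i.
  A tour is encoded by a successor function tr on pair indices: after
  delivering y i the tour goes to pickup x (tr i).\<close>

definition cyc :: "(nat \<Rightarrow> nat) \<Rightarrow> nat \<Rightarrow> nat set" where
  "cyc f i = {(f ^^ k) i | k. True}"

definition sc_length :: "nat \<Rightarrow> (nat \<Rightarrow> 'a::metric_space) \<Rightarrow> (nat \<Rightarrow> 'a) \<Rightarrow> (nat \<Rightarrow> nat) \<Rightarrow> real" where
  "sc_length n x y tr = (\<Sum>i<n. dist (x i) (y i) + dist (y i) (x (tr i)))"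

definition sc_tour :: "nat \<Rightarrow> (nat \<Rightarrow> nat) \<Rightarrow> bool" where
  "sc_tour n tr \<longleftrightarrow> tr permutes {..<n} \<and> (\<forall>i<n. \<forall>j<n. \<exists>k. (tr ^^ k) i = j)"

definition sc_opt :: "nat \<Rightarrow> (nat \<Rightarrow> 'a::metric_space) \<Rightarrow> (nat \<Rightarrow> 'a) \<Rightarrow> real" where
  "sc_opt n x y = Min {sc_length n x y tr | tr. sc_tour n tr}"

text \<open>tr is a possible output of SPLICE (for some admissible choice of the optimal
  matching, ordering of subtours, base, and ties in nearest pickups).\<close>
definition splice_output :: "nat \<Rightarrow> (nat \<Rightarrow> 'a::metric_space) \<Rightarrow> (nat \<Rightarrow> 'a) \<Rightarrow> (nat \<Rightarrow> nat) \<Rightarrow> bool" where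
  "splice_output n x y tr \<longleftrightarrow> 0 < n \<and>
    (\<exists>\<sigma> N C p nx.
       \<sigma> permutes {..<n} \<and>
       (\<forall>\<tau>. \<tau> permutes {..<n} \<longrightarrow>
            (\<Sum>i<n. dist (x (\<sigma> i)) (y i)) \<le> (\<Sum>i<n. dist (x (\<tau> i)) (y i))) \<and>
       bij_betw C {..<N} {cyc \<sigma> i | i. i < n} \<and>
       p 0 \<in> C 0 \<and>
       (\<forall>k. Suc k < N \<longrightarrow>
           nx k \<in> C (Suc k) \<and>
           (\<forall>j\<in>C (Suc k). dist (y (p k)) (x (nx k)) \<le> dist (y (p k)) (x j)) \<and>
           \<sigma> (p (Suc k)) = nx k) \<and>
       (\<forall>k. Suc k < N \<longrightarrow> tr (p k) = nx k) \<and>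
       tr (p (N - 1)) = \<sigma> (p 0) \<and>
       (\<forall>i<n. i \<notin> p ` {..<N} \<longrightarrow> tr i = \<sigma> i))"

end

theory Submission
  imports Defs "HOL-Combinatorics.Orbits" "HOL-Real_Asymp.Real_Asymp"
begin

text \<open>
  Every tour is in particular a matching, so an optimal tour is at least as long as the links
  x i to y i together with the optimal matching. SPLICE adds to this at most one link of bounded
  length per cycle of the matching, while the links x i to y i alone have total length of order n
  almost surely (Hoeffding and Borel-Cantelli). It therefore suffices that the optimal matching has
  o(n) cycles. In dimension at least 2 the optimal matching is almost surely unique, since for
  distinct a and b the level sets of dist z a - dist z b are null sets (this fails in dimension 1);
  by exchangeability it is then a uniformly random permutation. The sum of 2^(number of cycles) over
  all permutations of n points is (n+1)!, so Markov's inequality bounds the probability that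
  2^(number of cycles) is at least (n+1)^3 by 1/(n+1)^2, which is summable.
\<close>

section \<open>Cycles of permutations\<close>

lemma cyc_eq_orbit: "permutation f \<Longrightarrow> cyc f i = orbit f i"
  by (simp add: cyc_def orbit_altdef_permutation)

lemma permutes_lessThan_permutation: "f permutes {..<n::nat} \<Longrightarrow> permutation f"
  using permutation_permutes by blast

lemma self_in_cyc: "i \<in> cyc f i"
  unfolding cyc_def by (auto intro!: exI[of _ 0])

lemma cyc_eq_iff:
  assumes "permutation f"
  shows "cyc f i = cyc f j \<longleftrightarrow> j \<in> cyc f i"
proof
  assume "j \<in> cyc f i"
  then have "j \<in> orbit f i" by (simp add: cyc_eq_orbit assms)
  then have "orbit f j = orbit f i"
    by (rule orbit_cyclic_eq3[OF cyclic_on_orbit'[OF assms]])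
  then show "cyc f i = cyc f j" by (simp add: cyc_eq_orbit assms)
qed (metis self_in_cyc)

lemma cyc_step: "j \<in> cyc f i \<Longrightarrow> f j \<in> cyc f i"
  unfolding cyc_def by clarsimp (metis funpow.simps(2) comp_apply)

lemma cyc_subset_lessThan:
  assumes "f permutes {..<n}" "i < n"
  shows "cyc f i \<subseteq> {..<n}"
proof -
  have "(f ^^ k) i \<in> {..<n}" for k
    using permutes_in_funpow_image[OF assms(1), of i] assms(2) by auto
  then show ?thesis by (auto simp: cyc_def)
qed

definition num_cycles :: "nat \<Rightarrow> (nat \<Rightarrow> nat) \<Rightarrow> nat" where
  "num_cycles n f = card (cyc f ` {..<n})"

text \<open>Composing with the transposition splices \<open>n\<close> into the cycle of
  \<open>b\<close>, immediately before \<open>b\<close>, so no new cycle arises.\<close>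

lemma num_cycles_insert_le:
  assumes p: "p permutes {..<n}" and b: "b < n"
  shows "num_cycles (Suc n) (Transposition.transpose n b \<circ> p) \<le> num_cycles n p"
proof -
  define q where "q = Transposition.transpose n b \<circ> p"
  have q: "q permutes {..<Suc n}"
    unfolding q_def using p b
    by (intro permutes_compose[OF permutes_subset permutes_swap_id]) auto
  note perm = permutes_lessThan_permutation[OF q]
  have pn: "p n = n" using p by (auto simp: permutes_def)
  have qn: "q n = b" by (simp add: q_def pn)
  \<comment> \<open>One step of \<open>p\<close> is one step of \<open>q\<close>, or two when it
    leads to \<open>b\<close>: then \<open>q\<close> makes the detour through
    \<open>n\<close>.\<close>
  have step: "p j \<in> cyc q i" if "j \<in> cyc q i" "j < n" for i j
  proof -
    have "p j \<noteq> n" using p that(2) pn by (metis permutes_inj injD less_irrefl)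
    then have "q j = p j \<or> q (q j) = p j"
      using qn pn by (auto simp: q_def Transposition.transpose_def)
    then show ?thesis using cyc_step[OF that(1)] cyc_step by metis
  qed
  have sub: "cyc p i \<subseteq> cyc q i" if "i < n" for i
  proof
    fix j assume "j \<in> cyc p i"
    then obtain k where "j = (p ^^ k) i" by (auto simp: cyc_def)
    moreover have "(p ^^ k) i \<in> cyc q i \<and> (p ^^ k) i < n"
    proof (induction k)
      case 0 then show ?case using that self_in_cyc by simp
    next
      case (Suc k)
      then have "p ((p ^^ k) i) < n" using permutes_in_image[OF p] by auto
      then show ?case using Suc step by simp
    qed
    ultimately show "j \<in> cyc q i" by simp
  qed
  \<comment> \<open>\<open>g\<close> sends a cycle of \<open>p\<close> to the cycle of
    \<open>q\<close> that contains it; by \<open>sub\<close> the choice of representative does not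
    matter. Since \<open>n\<close> shares its cycle with \<open>b\<close>, every cycle of
    \<open>q\<close> is a value of \<open>g\<close>.\<close>
  define g where "g C = cyc q (SOME i. i \<in> C)" for C
  have g: "g (cyc p i) = cyc q i" if "i < n" for i
  proof -
    have "(SOME j. j \<in> cyc p i) \<in> cyc p i" by (rule someI[of _ i]) (rule self_in_cyc)
    then have "(SOME j. j \<in> cyc p i) \<in> cyc q i" using sub[OF that] by blast
    then show ?thesis unfolding g_def using cyc_eq_iff[OF perm] by metis
  qed
  have "cyc q n = cyc q b"
    using cyc_eq_iff[OF perm] cyc_step[OF self_in_cyc, of q n] qn by metis
  then have "cyc q ` {..<Suc n} = cyc q ` {..<n}"
    using b by (auto simp: lessThan_Suc)
  also have "\<dots> = g ` cyc p ` {..<n}"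
    unfolding image_image using g by (intro image_cong) auto
  finally show ?thesis
    unfolding num_cycles_def q_def[symmetric] by (simp add: card_image_le)
qed

text \<open>The cycle-counting polynomial of the symmetric group is x (x + 1) ... (x + n - 1), here
  at x = 2. In the induction step the choice b = n makes the new point a fixed point and at most
  doubles the weight, while each of the n choices b < n creates no cycle; this gives the factor n +
  2.\<close>

lemma sum_two_power_num_cycles_le:
  "(\<Sum>p | p permutes {..<n}. 2 ^ num_cycles n p) \<le> (fact (Suc n) :: nat)"
proof (induction n)
  case 0
  then show ?case by (simp add: num_cycles_def)
next
  case (Suc n)
  let ?P = "{p. p permutes {..<n}}"
  let ?S = "\<Sum>p\<in>?P. (2::nat) ^ num_cycles n p"
  have *: "num_cycles (Suc n) p \<le> Suc (num_cycles n p)" for p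
    unfolding num_cycles_def lessThan_Suc by (simp add: card_insert_le_m1 card_insert_if)
  have "(\<Sum>p | p permutes {..<Suc n}. (2::nat) ^ num_cycles (Suc n) p) =
      (\<Sum>b\<in>insert n {..<n}. \<Sum>p\<in>?P. 2 ^ num_cycles (Suc n) (Transposition.transpose n b \<circ> p))"
    unfolding lessThan_Suc by (rule sum_over_permutations_insert) auto
  also have "\<dots> = (\<Sum>p\<in>?P. 2 ^ num_cycles (Suc n) p) +
      (\<Sum>b<n. \<Sum>p\<in>?P. 2 ^ num_cycles (Suc n) (Transposition.transpose n b \<circ> p))"
    by simp
  also have "\<dots> \<le> (\<Sum>p\<in>?P. 2 * 2 ^ num_cycles n p) + (\<Sum>b<n. ?S)"
  proof (intro add_mono sum_mono)
    fix p
    have "(2::nat) ^ num_cycles (Suc n) p \<le> 2 ^ Suc (num_cycles n p)"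
      using * by (intro power_increasing) auto
    then show "(2::nat) ^ num_cycles (Suc n) p \<le> 2 * 2 ^ num_cycles n p" by simp
  next
    fix b p assume "b \<in> {..<n}" "p \<in> ?P"
    then show "(2::nat) ^ num_cycles (Suc n) (Transposition.transpose n b \<circ> p) \<le> 2 ^ num_cycles n p"
      using num_cycles_insert_le by (intro power_increasing) auto
  qed
  also have "\<dots> = (n + 2) * ?S" by (simp add: sum_distrib_left[symmetric])
  also have "\<dots> \<le> (n + 2) * fact (Suc n)" using Suc by (intro mult_left_mono) auto
  finally show ?case by (simp add: algebra_simps)
qed

section \<open>The SPLICE tour\<close>

text \<open>Starting at \<open>\<sigma> (p 0)\<close>, the tour runs through \<open>C 0\<close> up
  to \<open>p 0\<close>, jumps to \<open>nx 0 = \<sigma> (p 1)\<close>, runs through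
  \<open>C 1\<close> up to \<open>p 1\<close>, and so on, until \<open>p (N - 1)\<close> leads back
  to the start. The output \<open>tr\<close> is unconstrained from \<open>n\<close> on, whereas a
  tour must permute, hence the identity there.\<close>

lemma splice_is_tour:
  assumes n: "0 < n" and \<sigma>: "\<sigma> permutes {..<n}"
    and C: "bij_betw C {..<N} {cyc \<sigma> i | i. i < n}"
    and p0: "p 0 \<in> C 0"
    and nx: "\<And>k. Suc k < N \<Longrightarrow> nx k \<in> C (Suc k)"
    and pS: "\<And>k. Suc k < N \<Longrightarrow> \<sigma> (p (Suc k)) = nx k"
    and trp: "\<And>k. Suc k < N \<Longrightarrow> tr (p k) = nx k"
    and trl: "tr (p (N - 1)) = \<sigma> (p 0)"
    and tr: "\<And>i. i < n \<Longrightarrow> i \<notin> p ` {..<N} \<Longrightarrow> tr i = \<sigma> i"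
  shows "sc_tour n (\<lambda>i. if i < n then tr i else i)"
proof -
  define t where "t = (\<lambda>i. if i < n then tr i else i)"
  define s where "s = \<sigma> (p 0)"
  note perm = permutes_lessThan_permutation[OF \<sigma>]
  have N: "0 < N"
  proof (rule ccontr)
    assume "\<not> 0 < N"
    then have "{cyc \<sigma> i | i. i < n} = {}" using C by (simp add: bij_betw_def)
    then show False using n by auto
  qed
  have Cc: "\<exists>i<n. C k = cyc \<sigma> i" if "k < N" for k
  proof -
    have "C k \<in> {cyc \<sigma> i | i. i < n}" using bij_betwE[OF C] that by blast
    then show ?thesis by blast
  qed
  have Ceq: "C k = cyc \<sigma> i" if "k < N" "i \<in> C k" for k i
    using Cc[OF that(1)] that(2) cyc_eq_iff[OF perm] by metis
  have Cn: "C k \<subseteq> {..<n}" if "k < N" for k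
    using Cc[OF that] cyc_subset_lessThan[OF \<sigma>] by metis
  have pC: "p k \<in> C k" if "k < N" for k
  proof (cases k)
    case 0 then show ?thesis using p0 by simp
  next
    case (Suc m)
    have "\<sigma> (p k) \<in> C k" using nx[of m] pS[of m] that Suc by simp
    moreover have "cyc \<sigma> (p k) = cyc \<sigma> (\<sigma> (p k))"
      using cyc_eq_iff[OF perm] cyc_step[OF self_in_cyc] by metis
    ultimately show ?thesis using Ceq[OF that] self_in_cyc by metis
  qed
  \<comment> \<open>Each cycle contains exactly one point of \<open>p\<close>, so inside
    \<open>C k\<close> only the link leaving \<open>p k\<close> can be altered.\<close>
  have pk: "i = p k" if iC: "i \<in> C k" and k: "k < N" and ip: "i \<in> p ` {..<N}" for i k
  proof -
    obtain k' where k': "k' < N" "i = p k'" using ip by auto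
    then have "C k = C k'" using Ceq iC k pC by metis
    then show ?thesis using C k' k by (auto simp: bij_betw_def inj_on_def)
  qed
  \<comment> \<open>Walking round \<open>C k\<close> from \<open>\<sigma> (p k)\<close>, the maps
    \<sigma> and \<open>t\<close> agree until \<open>p k\<close> is met; from there the
    \<sigma>-walk merely returns to \<open>\<sigma> (p k)\<close>, which is in the orbit by
    assumption.\<close>
  have whole: "C k \<subseteq> cyc t s" if k: "k < N" and st: "\<sigma> (p k) \<in> cyc t s" for k
  proof
    fix j assume "j \<in> C k"
    have "\<sigma> (p k) \<in> C k" using pC[OF k] Ceq[OF k] cyc_step self_in_cyc by metis
    then have "j \<in> cyc \<sigma> (\<sigma> (p k))" using \<open>j \<in> C k\<close> Ceq[OF k] by metis
    then obtain m where "j = (\<sigma> ^^ m) (\<sigma> (p k))" by (auto simp: cyc_def)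
    moreover have "(\<sigma> ^^ m) (\<sigma> (p k)) \<in> cyc t s \<and> (\<sigma> ^^ m) (\<sigma> (p k)) \<in> C k"
    proof (induction m)
      case 0 then show ?case using st \<open>\<sigma> (p k) \<in> C k\<close> by simp
    next
      case (Suc m)
      let ?u = "(\<sigma> ^^ m) (\<sigma> (p k))"
      have "\<sigma> ?u \<in> C k" using Suc Ceq[OF k] cyc_step self_in_cyc by metis
      moreover have "\<sigma> ?u \<in> cyc t s"
      proof (cases "?u = p k")
        case True then show ?thesis using st by simp
      next
        case False
        then have "?u < n" "?u \<notin> p ` {..<N}" using pk Suc k Cn by auto
        then have "\<sigma> ?u = t ?u" by (simp add: t_def tr)
        then show ?thesis using Suc cyc_step by metis
      qed
      ultimately show ?case by simp
    qed
    ultimately show "j \<in> cyc t s" by simp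
  qed
  have all: "k < N \<Longrightarrow> \<sigma> (p k) \<in> cyc t s" for k
  proof (induction k)
    case 0 then show ?case using self_in_cyc by (simp add: s_def)
  next
    case (Suc k)
    then have "p k \<in> cyc t s" using whole[of k] pC[of k] by auto
    moreover have "t (p k) = \<sigma> (p (Suc k))"
      using trp[of k] pS[of k] Suc.prems pC[of k] Cn[of k] by (auto simp: t_def)
    ultimately show ?case using cyc_step by metis
  qed
  have reach: "i \<in> cyc t s" if "i < n" for i
  proof -
    have "cyc \<sigma> i \<in> C ` {..<N}" using C that by (auto simp: bij_betw_def)
    then obtain k where "k < N" "C k = cyc \<sigma> i" by auto
    then show ?thesis using whole all self_in_cyc by blast
  qed
  have last: "p (N - 1) < n" "t (p (N - 1)) = s"
    using pC[of "N - 1"] Cn[of "N - 1"] N trl by (auto simp: t_def s_def)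
  have s: "s < n" using \<sigma> p0 Cn[OF N] permutes_in_image[OF \<sigma>] by (auto simp: s_def)
  have maps: "t i < n" if "i < n" for i
  proof (cases "i \<in> p ` {..<N}")
    case True
    then obtain k where k: "k < N" "i = p k" by auto
    show ?thesis
    proof (cases "Suc k < N")
      case True
      then show ?thesis using trp[OF True] nx[OF True] Cn[OF True] k that by (auto simp: t_def)
    next
      case False
      then have "k = N - 1" using k by simp
      then show ?thesis using last k s by simp
    qed
  next
    case False
    then have "t i = \<sigma> i" using tr that by (simp add: t_def)
    then show ?thesis using permutes_in_image[OF \<sigma>] that by auto
  qed
  have iter: "(t ^^ k) s < n" for k by (induction k) (auto simp: s maps)
  \<comment> \<open>So far \<open>cyc t s\<close> is only a forward orbit. Every iterate after the
    first has a predecessor in the orbit, and \<open>s\<close> itself is the image of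
    \<open>p (N - 1)\<close>; surjectivity on a finite set then makes \<open>t\<close> a
    permutation, whose orbits are symmetric.\<close>
  have "{..<n} \<subseteq> t ` {..<n}"
  proof
    fix j assume "j \<in> {..<n}"
    then obtain k where k: "j = (t ^^ k) s" using reach by (auto simp: cyc_def)
    show "j \<in> t ` {..<n}"
    proof (cases k)
      case 0 then show ?thesis using k last by force
    next
      case (Suc m) then show ?thesis using k iter[of m] by auto
    qed
  qed
  then have img: "t ` {..<n} = {..<n}" using maps by auto
  then have "bij_betw t {..<n} {..<n}"
    by (simp add: bij_betw_def eq_card_imp_inj_on)
  then have t: "t permutes {..<n}"
    by (rule bij_imp_permutes) (auto simp: t_def)
  have "\<exists>k. (t ^^ k) i = j" if "i < n" "j < n" for i j
  proof -
    have "j \<in> cyc t i"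
      using reach[OF that(1)] reach[OF that(2)] cyc_eq_iff[OF permutes_lessThan_permutation[OF t]]
      by metis
    then show ?thesis by (auto simp: cyc_def)
  qed
  with t show ?thesis unfolding sc_tour_def t_def by blast
qed

definition matching_cost :: "nat \<Rightarrow> (nat \<Rightarrow> 'a::metric_space) \<Rightarrow> (nat \<Rightarrow> 'a) \<Rightarrow> (nat \<Rightarrow> nat) \<Rightarrow> real" where
  "matching_cost n x y \<sigma> = (\<Sum>i<n. dist (x (\<sigma> i)) (y i))"

text \<open>The competitors are written as a set so that, for random points, optimality is visibly a
  finite conjunction of measurable conditions.\<close>

definition optimal_matching :: "nat \<Rightarrow> (nat \<Rightarrow> 'a::metric_space) \<Rightarrow> (nat \<Rightarrow> 'a) \<Rightarrow> (nat \<Rightarrow> nat) \<Rightarrow> bool" where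
  "optimal_matching n x y \<sigma> \<longleftrightarrow> \<sigma> permutes {..<n} \<and>
    (\<forall>\<tau>\<in>{\<tau>. \<tau> permutes {..<n}}. matching_cost n x y \<sigma> \<le> matching_cost n x y \<tau>)"

lemma sc_length_cong:
  "(\<And>i. i < n \<Longrightarrow> f i = g i) \<Longrightarrow> sc_length n x y f = sc_length n x y g"
  unfolding sc_length_def by (rule sum.cong) auto

lemma finite_sc_lengths: "finite {sc_length n x y tr | tr. sc_tour n tr}"
proof -
  have "finite (sc_length n x y ` {tr. tr permutes {..<n}})"
    by (simp add: finite_permutations)
  then show ?thesis by (rule finite_subset[rotated]) (auto simp: sc_tour_def)
qed

text \<open>The lower bound holds because a tour is a matching as well; the upper bound because the
  tour departs from the matching at no more than one delivery per cycle. The matching is hidden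
  behind an existential quantifier in \<open>splice_output\<close>, so it is obtained here, and the
  error depends on it only through its number of cycles.\<close>

lemma splice_output_bounds:
  assumes sp: "splice_output n x y tr"
    and D: "\<And>i j. i < n \<Longrightarrow> j < n \<Longrightarrow> dist (y i) (x j) \<le> D"
  obtains \<sigma> where "optimal_matching n x y \<sigma>"
    "(\<Sum>i<n. dist (x i) (y i)) \<le> sc_opt n x y"
    "sc_opt n x y \<le> sc_length n x y tr"
    "sc_length n x y tr \<le> sc_opt n x y + real (num_cycles n \<sigma>) * D"
proof -
  obtain \<sigma> N C p nx where n: "0 < n" and \<sigma>: "\<sigma> permutes {..<n}"
    and opt: "\<forall>\<tau>. \<tau> permutes {..<n} \<longrightarrow>
            (\<Sum>i<n. dist (x (\<sigma> i)) (y i)) \<le> (\<Sum>i<n. dist (x (\<tau> i)) (y i))"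
    and C: "bij_betw C {..<N} {cyc \<sigma> i | i. i < n}"
    and p0: "p 0 \<in> C 0"
    and nx: "\<forall>k. Suc k < N \<longrightarrow>
           nx k \<in> C (Suc k) \<and>
           (\<forall>j\<in>C (Suc k). dist (y (p k)) (x (nx k)) \<le> dist (y (p k)) (x j)) \<and>
           \<sigma> (p (Suc k)) = nx k"
    and trp: "\<forall>k. Suc k < N \<longrightarrow> tr (p k) = nx k"
    and trl: "tr (p (N - 1)) = \<sigma> (p 0)"
    and tr: "\<forall>i<n. i \<notin> p ` {..<N} \<longrightarrow> tr i = \<sigma> i"
    using sp unfolding splice_output_def by auto
  define t where "t = (\<lambda>i. if i < n then tr i else i)"
  define m where "m = (\<Sum>i<n. dist (x (\<sigma> i)) (y i))"
  let ?L = "{sc_length n x y tr | tr. sc_tour n tr}"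
  have tour: "sc_tour n t"
    unfolding t_def
    by (rule splice_is_tour[where \<sigma> = \<sigma> and N = N and C = C and p = p and nx = nx])
      (use n \<sigma> C p0 nx trp trl tr in auto)
  then have tn: "t i < n" if "i < n" for i
    using that permutes_in_image[of t "{..<n}" i] by (auto simp: sc_tour_def)
  have len: "sc_length n x y tr = sc_length n x y t"
    by (rule sc_length_cong) (simp add: t_def)
  have N: "num_cycles n \<sigma> = N"
  proof -
    have "cyc \<sigma> ` {..<n} = {cyc \<sigma> i | i. i < n}" by auto
    then show ?thesis using bij_betw_same_card[OF C] by (simp add: num_cycles_def)
  qed
  have "sc_opt n x y \<in> ?L"
    unfolding sc_opt_def by (rule Min_in[OF finite_sc_lengths]) (use tour in blast)
  then obtain u where u: "sc_tour n u" "sc_opt n x y = sc_length n x y u" by auto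
  have low: "(\<Sum>i<n. dist (x i) (y i)) + m \<le> sc_opt n x y"
    using opt u unfolding m_def sc_length_def sc_tour_def
    by (simp add: sum.distrib dist_commute)
  have m0: "0 \<le> m" by (simp add: m_def sum_nonneg)
  have D0: "0 \<le> D" using D[OF n n] zero_le_dist order_trans by blast
  \<comment> \<open>The length of a removed link stays in the bound, with \<open>D\<close> on top
    for its replacement, so that the right side contains the full matching cost
    \<open>m\<close>.\<close>
  have "(\<Sum>i<n. dist (y i) (x (t i))) \<le>
      (\<Sum>i<n. dist (x (\<sigma> i)) (y i) + (if i \<in> p ` {..<N} then D else 0))"
  proof (rule sum_mono)
    fix i assume "i \<in> {..<n}"
    then have i: "i < n" by simp
    show "dist (y i) (x (t i)) \<le> dist (x (\<sigma> i)) (y i) + (if i \<in> p ` {..<N} then D else 0)"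
    proof (cases "i \<in> p ` {..<N}")
      case True
      then show ?thesis using D[OF i tn[OF i]] by (simp add: add_increasing)
    next
      case False
      then show ?thesis using tr i by (simp add: t_def dist_commute)
    qed
  qed
  also have "\<dots> = m + D * card ({..<n} \<inter> p ` {..<N})"
    by (simp add: sum.distrib m_def sum.If_cases algebra_simps)
  also have "\<dots> \<le> m + D * N"
  proof -
    have "card ({..<n} \<inter> p ` {..<N}) \<le> card (p ` {..<N})" by (intro card_mono) auto
    also have "\<dots> \<le> N" using card_image_le[of "{..<N}" p] by simp
    finally show ?thesis using D0 by (intro add_left_mono mult_left_mono) auto
  qed
  finally have up: "sc_length n x y t \<le> (\<Sum>i<n. dist (x i) (y i)) + m + D * N"
    by (simp add: sc_length_def sum.distrib)
  have "optimal_matching n x y \<sigma>" using \<sigma> opt by (simp add: optimal_matching_def matching_cost_def)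
  moreover have "(\<Sum>i<n. dist (x i) (y i)) \<le> sc_opt n x y" using low m0 by linarith
  moreover have "sc_opt n x y \<le> sc_length n x y tr"
    unfolding len sc_opt_def by (rule Min_le[OF finite_sc_lengths]) (use tour in blast)
  moreover have "sc_length n x y tr \<le> sc_opt n x y + real (num_cycles n \<sigma>) * D"
    using up low len N by (simp add: mult.commute)
  ultimately show ?thesis by (rule that)
qed

section \<open>Hyperboloids are null sets\<close>

text \<open>By translation invariance, the measure of A times the length of the real line is the integral
  over z of the length of the section of A by the line through z in direction v.\<close>

lemma null_sets_lborel_if_finite_on_lines:
  fixes v :: "'a::euclidean_space"
  assumes A: "A \<in> sets borel"
    and fin: "\<And>z. finite {t::real. z + t *\<^sub>R v \<in> A}"
  shows "A \<in> null_sets lborel"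
proof -
  have [measurable]: "A \<in> sets borel" by (rule A)
  have "emeasure lborel A * emeasure lborel (UNIV :: real set) =
      (\<integral>\<^sup>+(t::real). emeasure lborel A \<partial>lborel)"
    by simp
  also have "\<dots> = (\<integral>\<^sup>+(t::real). (\<integral>\<^sup>+z. indicator A (z + t *\<^sub>R v) \<partial>lborel) \<partial>lborel)"
  proof (rule nn_integral_cong)
    fix t :: real
    have "emeasure lborel A = (\<integral>\<^sup>+z. indicator A z \<partial>distr lborel borel ((+) (t *\<^sub>R v)))"
      by (simp add: lborel_distr_plus)
    also have "\<dots> = (\<integral>\<^sup>+z. indicator A (z + t *\<^sub>R v) \<partial>lborel)"
      by (subst nn_integral_distr) (auto simp: add.commute)
    finally show "emeasure lborel A = (\<integral>\<^sup>+z. indicator A (z + t *\<^sub>R v) \<partial>lborel)" .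
  qed
  also have "\<dots> = (\<integral>\<^sup>+z. (\<integral>\<^sup>+(t::real). indicator A (z + t *\<^sub>R v) \<partial>lborel) \<partial>lborel)"
    by (rule lborel_pair.Fubini') measurable
  also have "\<dots> = (\<integral>\<^sup>+(z::'a). 0 \<partial>lborel)"
  proof (rule nn_integral_cong)
    fix z
    have "(\<integral>\<^sup>+(t::real). indicator A (z + t *\<^sub>R v) \<partial>lborel) =
        (\<integral>\<^sup>+(t::real). indicator {t. z + t *\<^sub>R v \<in> A} t \<partial>lborel)"
      by (rule nn_integral_cong) (simp add: indicator_def)
    also have "\<dots> = emeasure lborel {t. z + t *\<^sub>R v \<in> A}"
      by (rule nn_integral_indicator) measurable
    also have "\<dots> = 0"
      by (rule emeasure_lborel_countable) (simp add: fin countable_finite)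
    finally show "(\<integral>\<^sup>+(t::real). indicator A (z + t *\<^sub>R v) \<partial>lborel) = 0" .
  qed
  finally have "emeasure lborel A * \<infinity> = 0" by simp
  then have "emeasure lborel A = 0" by (simp add: ennreal_mult_eq_top_iff)
  then show ?thesis using A by auto
qed

lemma finite_quadratic_roots:
  fixes p q r :: real
  assumes "p \<noteq> 0 \<or> q \<noteq> 0"
  shows "finite {t. p * t\<^sup>2 + q * t + r = 0}"
proof -
  have "{t. p * t\<^sup>2 + q * t + r = 0} = {t. poly [:r, q, p:] t = 0}"
    by (simp add: power2_eq_square algebra_simps)
  moreover have "finite {t. poly [:r, q, p:] t = 0}"
    using assms by (intro poly_roots_finite) auto
  ultimately show ?thesis by simp
qed

text \<open>Where dist z a - dist z b = c, squaring gives (l z)^2 = 4 c^2 |z - b|^2 with l affine and of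
  gradient 2 (b - a); a line orthogonal to b - a (if c is nonzero) or parallel to it (if c = 0)
  meets this set in at most two points.\<close>

lemma hyperboloid_null_sets:
  fixes a b :: "'a::euclidean_space"
  assumes dim: "2 \<le> DIM('a)" and ab: "a \<noteq> b"
  shows "{z. dist z a - dist z b = c} \<in> null_sets lborel"
proof -
  have eq: "2 * ((b - a) \<bullet> (z - b)) + (b - a) \<bullet> (b - a) - c\<^sup>2 = 2 * c * dist z b"
    if "dist z a - dist z b = c" for z
  proof -
    have "dist z a = c + dist z b" using that by simp
    then have "(dist z a)\<^sup>2 = (c + dist z b)\<^sup>2" by simp
    moreover have "(dist z a)\<^sup>2 = (z - a) \<bullet> (z - a)" "(dist z b)\<^sup>2 = (z - b) \<bullet> (z - b)"
      by (simp_all add: dist_norm power2_norm_eq_inner)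
    ultimately show ?thesis
      by (simp add: power2_eq_square inner_diff inner_commute algebra_simps)
  qed
  \<comment> \<open>For nonzero \<open>c\<close> the dimension supplies a direction orthogonal to
    \<open>b - a\<close>. On the real line, with c = |a - b|, the set would be a half-line.\<close>
  obtain v where v: "v \<noteq> 0" "(c = 0 \<and> v = b - a) \<or> (c \<noteq> 0 \<and> (b - a) \<bullet> v = 0)"
  proof (cases "c = 0")
    case True
    then show thesis using that[of "b - a"] ab by simp
  next
    case False
    obtain w where "w \<noteq> 0" "orthogonal (b - a) w"
      using orthogonal_to_vector_exists[OF dim] by metis
    then show thesis using that[of w] False by (simp add: orthogonal_def)
  qed
  show ?thesis
  proof (rule null_sets_lborel_if_finite_on_lines[where v = v])
    show "{z. dist z a - dist z b = c} \<in> sets borel" by measurable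
  next
    fix z
    let ?w = "z - b" and ?k = "(b - a) \<bullet> (b - a) - c\<^sup>2"
    show "finite {t. z + t *\<^sub>R v \<in> {z. dist z a - dist z b = c}}"
    proof (cases "c = 0")
      case True
      then have vv: "v = b - a" using v by simp
      \<comment> \<open>For \<open>c = 0\<close> the set is the perpendicular bisector of
        \<open>a\<close> and \<open>b\<close>, and \<open>eq\<close> is already a linear equation in
        \<open>t\<close> with slope \<open>2 * (v \<bullet> v)\<close>.\<close>
      have "{t. z + t *\<^sub>R v \<in> {z. dist z a - dist z b = c}} \<subseteq>
          {t. 0 * t\<^sup>2 + (2 * (v \<bullet> v)) * t + (2 * (v \<bullet> ?w) + v \<bullet> v) = 0}"
      proof (intro subsetI CollectI)
        fix t assume "t \<in> {t. z + t *\<^sub>R v \<in> {z. dist z a - dist z b = c}}"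
        then have "dist (z + t *\<^sub>R v) a - dist (z + t *\<^sub>R v) b = c" by simp
        from eq[OF this] True show "0 * t\<^sup>2 + 2 * (v \<bullet> v) * t + (2 * (v \<bullet> ?w) + v \<bullet> v) = 0"
          unfolding vv[symmetric] by (simp add: inner_diff inner_add algebra_simps)
      qed
      then show ?thesis by (rule finite_subset) (rule finite_quadratic_roots, use v in simp)
    next
      case False
      then have orth: "(b - a) \<bullet> v = 0" using v by simp
      let ?l = "2 * ((b - a) \<bullet> ?w) + ?k"
      \<comment> \<open>Along \<open>v\<close> the affine side of \<open>eq\<close> keeps the
        constant value \<open>?l\<close>, so squaring leaves a quadratic in \<open>t\<close> whose
        leading coefficient \<open>4 * c\<^sup>2 * (v \<bullet> v)\<close> is nonzero.\<close>
      have "{t. z + t *\<^sub>R v \<in> {z. dist z a - dist z b = c}} \<subseteq>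
          {t. (4 * c\<^sup>2 * (v \<bullet> v)) * t\<^sup>2 + (8 * c\<^sup>2 * (v \<bullet> ?w)) * t + (4 * c\<^sup>2 * (?w \<bullet> ?w) - ?l\<^sup>2) = 0}"
      proof (intro subsetI CollectI)
        fix t assume "t \<in> {t. z + t *\<^sub>R v \<in> {z. dist z a - dist z b = c}}"
        then have "dist (z + t *\<^sub>R v) a - dist (z + t *\<^sub>R v) b = c" by simp
        note E = eq[OF this]
        have "z + t *\<^sub>R v - b = ?w + t *\<^sub>R v" by simp
        then have "(b - a) \<bullet> (z + t *\<^sub>R v - b) = (b - a) \<bullet> ?w"
          using orth by (simp only: inner_add_right inner_scaleR_right)
        with E have "?l = 2 * c * dist (z + t *\<^sub>R v) b" by simp
        then have "?l\<^sup>2 = (2 * c * dist (z + t *\<^sub>R v) b)\<^sup>2" by simp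
        also have "\<dots> = 4 * c\<^sup>2 * (dist (z + t *\<^sub>R v) b)\<^sup>2" by (simp add: power_mult_distrib)
        also have "(dist (z + t *\<^sub>R v) b)\<^sup>2 = (?w + t *\<^sub>R v) \<bullet> (?w + t *\<^sub>R v)"
          by (simp add: dist_norm power2_norm_eq_inner algebra_simps)
        also have "\<dots> = ?w \<bullet> ?w + 2 * t * (v \<bullet> ?w) + t\<^sup>2 * (v \<bullet> v)"
          by (simp only: inner_add inner_scaleR_right inner_scaleR_left)
             (simp only: inner_commute[of ?w v], simp add: power2_eq_square algebra_simps)
        finally show "4 * c\<^sup>2 * (v \<bullet> v) * t\<^sup>2 + 8 * c\<^sup>2 * (v \<bullet> ?w) * t + (4 * c\<^sup>2 * (?w \<bullet> ?w) - ?l\<^sup>2) = 0"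
          by (simp add: algebra_simps)
      qed
      then show ?thesis
        by (rule finite_subset) (rule finite_quadratic_roots, use v False in simp)
    qed
  qed
qed

section \<open>The random optimal matching\<close>

text \<open>Fubini: for each fixed value of \<open>R\<close> the bad set is Lebesgue null, hence
  null for the absolutely continuous law of \<open>Z\<close>. Independence enters as factorization
  of the joint law because \<open>R\<close> and \<open>Z\<close> take values in different types;
  below, \<open>R\<close> collects all points but one.\<close>

lemma (in prob_space) AE_avoids_null_sections:
  assumes R [measurable]: "R \<in> measurable M N"
    and joint: "distr M N R \<Otimes>\<^sub>M distr M borel Z = distr M (N \<Otimes>\<^sub>M borel) (\<lambda>\<omega>. (R \<omega>, Z \<omega>))"
    and Z: "distributed M lborel Z f"
    and P: "Measurable.pred (N \<Otimes>\<^sub>M borel) (\<lambda>(r, z). P r z)"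
    and null: "\<And>r. r \<in> space N \<Longrightarrow> {z. P r z} \<in> null_sets lborel"
  shows "AE \<omega> in M. \<not> P (R \<omega>) (Z \<omega>)"
proof -
  have [measurable]: "Z \<in> measurable M borel"
    using distributed_measurable[OF Z] by simp
  interpret R: prob_space "distr M N R" by (rule prob_space_distr) simp
  interpret Z: prob_space "distr M borel Z" by (rule prob_space_distr) simp
  interpret RZ: pair_sigma_finite "distr M N R" "distr M borel Z" ..
  have dZ: "distr M borel Z = density lborel f"
    using distributed_distr_eq_density[OF Z] by (simp cong: distr_cong)
  have f: "f \<in> borel_measurable lborel" using Z by (rule distributed_borel_measurable)
  have P': "Measurable.pred (N \<Otimes>\<^sub>M borel) (\<lambda>x. \<not> P (fst x) (snd x))"
    using P by (simp add: split_beta')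
  have "AE r in distr M N R. AE z in distr M borel Z. \<not> P r z"
  proof (rule AE_I2)
    fix r assume "r \<in> space (distr M N R)"
    then have "AE z in lborel. \<not> P r z"
      using AE_not_in[OF null[of r]] by simp
    then show "AE z in distr M borel Z. \<not> P r z"
      unfolding dZ using f by (auto simp: AE_density)
  qed
  then have "AE x in distr M N R \<Otimes>\<^sub>M distr M borel Z. \<not> P (fst x) (snd x)"
    using P' by (subst (asm) RZ.AE_pair_iff)
      (simp_all add: split_beta' pred_def space_pair_measure cong: sets_pair_measure_cong)
  then have "AE x in distr M (N \<Otimes>\<^sub>M borel) (\<lambda>\<omega>. (R \<omega>, Z \<omega>)). \<not> P (fst x) (snd x)"
    unfolding joint .
  then show ?thesis by (subst (asm) AE_distr_iff) (use P' in \<open>simp_all add: pred_def\<close>)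
qed

text \<open>The singleton blocks \<open>{h k}\<close> are disjoint because \<open>h\<close> is
  injective, so the restrictions to them are independent; evaluation at the single index of each
  block recovers the variables.\<close>

lemma (in prob_space) indep_vars_reindex_inj:
  assumes ind: "indep_vars (\<lambda>_. N) Z UNIV" and h: "inj h"
  shows "indep_vars (\<lambda>_. N) (\<lambda>k. Z (h k)) UNIV"
proof -
  have dj: "disjoint_family_on (\<lambda>k. {h k}) UNIV"
    using h by (auto simp: disjoint_family_on_def dest: injD)
  have "indep_vars (\<lambda>k. PiM {h k} (\<lambda>_. N)) (\<lambda>k \<omega>. restrict (\<lambda>i. Z i \<omega>) {h k}) UNIV"
    by (rule indep_vars_restrict[OF ind _ dj]) simp
  then have "indep_vars (\<lambda>_. N) (\<lambda>k \<omega>. (\<lambda>f. f (h k)) (restrict (\<lambda>i. Z i \<omega>) {h k})) UNIV"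
    by (rule indep_vars_compose2[where Y = "\<lambda>k f. f (h k)"]) simp
  then show ?thesis by simp
qed

text \<open>Both blocks of coordinates are first kept as restricted functions, for which block
  independence applies; evaluating the one-point block at \<open>k\<close> then turns
  \<open>Q\<close> into \<open>Z k\<close>.\<close>

lemma (in prob_space) joint_law_coordinate:
  fixes k :: 'i
  assumes ind: "indep_vars (\<lambda>_. N) Z UNIV"
  defines "R \<equiv> \<lambda>\<omega>. restrict (\<lambda>i. Z i \<omega>) (- {k})"
  shows "R \<in> measurable M (PiM (- {k}) (\<lambda>_. N))"
    and "distr M (PiM (- {k}) (\<lambda>_. N)) R \<Otimes>\<^sub>M distr M N (Z k) =
      distr M (PiM (- {k}) (\<lambda>_. N) \<Otimes>\<^sub>M N) (\<lambda>\<omega>. (R \<omega>, Z k \<omega>))"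
proof -
  let ?P = "PiM (- {k}) (\<lambda>_. N)" and ?K = "PiM {k} (\<lambda>_. N)"
  define Q where "Q = (\<lambda>\<omega>. restrict (\<lambda>i. Z i \<omega>) {k})"
  have [measurable]: "Z i \<in> measurable M N" for i
    using ind by (auto simp: indep_vars_def)
  show R [measurable]: "R \<in> measurable M ?P"
    unfolding R_def by (rule measurable_restrict) simp
  have Q [measurable]: "Q \<in> measurable M ?K"
    unfolding Q_def by (rule measurable_restrict) simp
  have "indep_var ?P R ?K Q"
    unfolding R_def Q_def by (rule indep_var_restrict[OF ind]) auto
  then have joint: "distr M ?P R \<Otimes>\<^sub>M distr M ?K Q = distr M (?P \<Otimes>\<^sub>M ?K) (\<lambda>\<omega>. (R \<omega>, Q \<omega>))"
    by (simp add: indep_var_distribution_eq)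
  have ev: "(\<lambda>f. f k) \<in> measurable ?K N" by simp
  have Zk: "distr (distr M ?K Q) N (\<lambda>f. f k) = distr M N (Z k)"
    by (subst distr_distr[OF ev Q]) (simp add: comp_def Q_def)
  interpret Zk: prob_space "distr M N (Z k)" by (rule prob_space_distr) simp
  have "distr M ?P R \<Otimes>\<^sub>M distr M N (Z k) =
      distr (distr M ?P R) ?P (\<lambda>f. f) \<Otimes>\<^sub>M distr (distr M ?K Q) N (\<lambda>f. f k)"
    by (simp add: Zk distr_id2)
  also have "\<dots> = distr (distr M ?P R \<Otimes>\<^sub>M distr M ?K Q) (?P \<Otimes>\<^sub>M N) (\<lambda>(f, g). (f, g k))"
    by (rule pair_measure_distr) (simp_all add: Zk Zk.sigma_finite_measure_axioms)
  also have "\<dots> = distr M (?P \<Otimes>\<^sub>M N) (\<lambda>\<omega>. (R \<omega>, Z k \<omega>))"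
    unfolding joint by (subst distr_distr) (auto simp: comp_def Q_def)
  finally show "distr M ?P R \<Otimes>\<^sub>M distr M N (Z k) = distr M (?P \<Otimes>\<^sub>M N) (\<lambda>\<omega>. (R \<omega>, Z k \<omega>))" .
qed

section \<open>The random points and almost sure uniqueness of the optimal matching\<close>

locale random_pairs = prob_space M for M :: "'m measure" +
  fixes X Y :: "nat \<Rightarrow> 'm \<Rightarrow> 'a::euclidean_space"
    and fP fD :: "'a \<Rightarrow> ennreal"
  assumes X: "distributed M lborel (X i) fP"
    and Y: "distributed M lborel (Y i) fD"
    and indep: "indep_vars (\<lambda>_. borel) (case_sum X Y) UNIV"
begin

abbreviation Z :: "nat + nat \<Rightarrow> 'm \<Rightarrow> 'a" where
  "Z \<equiv> case_sum X Y"

lemma X_measurable [measurable]: "X i \<in> borel_measurable M"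
  using distributed_measurable[OF X] by simp

lemma Y_measurable [measurable]: "Y i \<in> borel_measurable M"
  using distributed_measurable[OF Y] by simp

lemma Z_measurable [measurable]: "Z k \<in> borel_measurable M"
  by (cases k) simp_all

lemma Z_distributed: "distributed M lborel (Z k) (case_sum (\<lambda>_. fP) (\<lambda>_. fD) k)"
  by (cases k) (simp_all add: X Y)

lemma Z_distr: "distr M borel (Z k) = density lborel (case_sum (\<lambda>_. fP) (\<lambda>_. fD) k)"
  using distributed_distr_eq_density[OF Z_distributed] by (simp cong: distr_cong)

text \<open>Single points are null sets. This serves twice: the two foci of a hyperboloid are
  distinct, and the mean distance from pickup to delivery is positive.\<close>

lemma AE_Z_neq:
  assumes "k \<noteq> l"
  shows "AE \<omega> in M. Z k \<omega> \<noteq> Z l \<omega>"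
proof -
  have l: "l \<in> - {k}" using assms by simp
  have "AE \<omega> in M. \<not> (restrict (\<lambda>i. Z i \<omega>) (- {k}) l = Z k \<omega>)"
  proof (rule AE_avoids_null_sections[OF joint_law_coordinate[OF indep] Z_distributed])
    show "Measurable.pred (PiM (- {k}) (\<lambda>_. borel) \<Otimes>\<^sub>M borel) (\<lambda>(r, z). (r l :: 'a) = z)"
      using l by measurable
    show "{z. r l = z} \<in> null_sets lborel" for r :: "nat + nat \<Rightarrow> 'a"
      by (simp add: finite_imp_null_set_lborel)
  qed
  then show ?thesis using l by (auto elim: eventually_mono)
qed

text \<open>Choose a pickup \<open>j\<close> that the two matchings serve from different deliveries
  \<open>i\<close> and \<open>i'\<close>. With all other points fixed, equal costs force
  \<open>X j\<close> onto a level set of the difference of the distances to \<open>Y i\<close> and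
  \<open>Y i'\<close>, which is null.\<close>

lemma AE_matching_cost_neq:
  assumes dim: "2 \<le> DIM('a)" and \<sigma>: "\<sigma> permutes {..<n}" and \<tau>: "\<tau> permutes {..<n}" and "\<sigma> \<noteq> \<tau>"
  shows "AE \<omega> in M. matching_cost n (\<lambda>i. X i \<omega>) (\<lambda>i. Y i \<omega>) \<sigma> \<noteq>
    matching_cost n (\<lambda>i. X i \<omega>) (\<lambda>i. Y i \<omega>) \<tau>"
proof -
  obtain i where i: "\<sigma> i \<noteq> \<tau> i" using \<open>\<sigma> \<noteq> \<tau>\<close> by auto
  then have "i < n" using \<sigma> \<tau> by (metis lessThan_iff permutes_not_in)
  define j where "j = \<sigma> i"
  have "j < n" using permutes_in_image[OF \<sigma>] \<open>i < n\<close> by (auto simp: j_def)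
  then obtain i' where i': "i' < n" "\<tau> i' = j"
    using permutes_image[OF \<tau>] by (metis imageE lessThan_iff)
  have "i \<noteq> i'" using i i' j_def by auto
  have inj: "inj \<sigma>" "inj \<tau>" using \<sigma> \<tau> by (auto simp: permutes_inj)
  let ?I = "- {Inl j :: nat + nat}"
  let ?R = "\<lambda>\<omega>. restrict (\<lambda>k. Z k \<omega>) ?I"
  \<comment> \<open>This is the cost of the remaining links of \<tau> minus that of \<sigma>; by
    \<open>\<sigma>j\<close> and \<open>\<tau>j\<close> below it does not involve the coordinate
    \<open>Inl j\<close>.\<close>
  define c where "c r = (\<Sum>k\<in>{..<n} - {i'}. dist (r (Inl (\<tau> k)) :: 'a) (r (Inr k))) -
      (\<Sum>k\<in>{..<n} - {i}. dist (r (Inl (\<sigma> k))) (r (Inr k)))" for r :: "nat + nat \<Rightarrow> 'a"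
  have \<sigma>j: "\<sigma> k \<noteq> j" if "k \<noteq> i" for k using inj(1) that j_def by (metis injD)
  have \<tau>j: "\<tau> k \<noteq> j" if "k \<noteq> i'" for k using inj(2) that i'(2) by (metis injD)
  \<comment> \<open>Distinct foci are made part of the bad event so that every section is null, also
    at those \<open>r\<close> where the foci coincide.\<close>
  let ?P = "\<lambda>r z. r (Inr i) \<noteq> r (Inr i') \<and> dist z (r (Inr i)) - dist z (r (Inr i')) = c r"
  have [measurable]: "c \<in> borel_measurable (PiM ?I (\<lambda>_. borel))"
    unfolding c_def using \<sigma>j \<tau>j
    by (intro borel_measurable_diff borel_measurable_sum borel_measurable_dist
      measurable_component_singleton) auto
  have "AE \<omega> in M. \<not> ?P (?R \<omega>) (Z (Inl j) \<omega>)"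
  proof (rule AE_avoids_null_sections[OF joint_law_coordinate[OF indep] Z_distributed])
    have [measurable]: "(\<lambda>r. r (Inr k)) \<in> measurable (PiM ?I (\<lambda>_. borel)) (borel :: 'a measure)" for k
      by measurable
    show "Measurable.pred (PiM ?I (\<lambda>_. borel) \<Otimes>\<^sub>M borel) (\<lambda>(r, z). ?P r z)"
      by measurable
    show "{z. ?P r z} \<in> null_sets lborel" for r
      using hyperboloid_null_sets[OF dim, of "r (Inr i)" "r (Inr i')" "c r"]
      by (cases "r (Inr i) = r (Inr i')") simp_all
  qed
  moreover have "AE \<omega> in M. Y i \<omega> \<noteq> Y i' \<omega>"
    using AE_Z_neq[of "Inr i" "Inr i'"] \<open>i \<noteq> i'\<close> by simp
  ultimately show ?thesis
  proof eventually_elim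
    case (elim \<omega>)
    have c: "c (?R \<omega>) = (\<Sum>k\<in>{..<n} - {i'}. dist (X (\<tau> k) \<omega>) (Y k \<omega>)) -
        (\<Sum>k\<in>{..<n} - {i}. dist (X (\<sigma> k) \<omega>) (Y k \<omega>))"
      unfolding c_def using \<sigma>j \<tau>j by (intro arg_cong2[where f = "(-)"] sum.cong) auto
    have "matching_cost n (\<lambda>i. X i \<omega>) (\<lambda>i. Y i \<omega>) \<sigma> =
        dist (X j \<omega>) (Y i \<omega>) + (\<Sum>k\<in>{..<n} - {i}. dist (X (\<sigma> k) \<omega>) (Y k \<omega>))"
      unfolding matching_cost_def using \<open>i < n\<close> by (subst sum.remove[of _ i]) (auto simp: j_def)
    moreover have "matching_cost n (\<lambda>i. X i \<omega>) (\<lambda>i. Y i \<omega>) \<tau> =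
        dist (X j \<omega>) (Y i' \<omega>) + (\<Sum>k\<in>{..<n} - {i'}. dist (X (\<tau> k) \<omega>) (Y k \<omega>))"
      unfolding matching_cost_def using i' by (subst sum.remove[of _ i']) auto
    ultimately show ?case using elim c by auto
  qed
qed

section \<open>Exchangeability and the number of cycles\<close>

lemma matching_cost_measurable [measurable]:
  "(\<lambda>\<omega>. matching_cost n (\<lambda>i. X i \<omega>) (\<lambda>i. Y i \<omega>) \<sigma>) \<in> borel_measurable M"
  unfolding matching_cost_def by measurable

lemma optimal_matching_measurable [measurable]:
  "Measurable.pred M (\<lambda>\<omega>. optimal_matching n (\<lambda>i. X i \<omega>) (\<lambda>i. Y i \<omega>) \<sigma>)"
  unfolding optimal_matching_def
  by (intro pred_intros_logic pred_intros_finite finite_permutations) measurable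

abbreviation optimal_event :: "nat \<Rightarrow> (nat \<Rightarrow> nat) \<Rightarrow> 'm set" where
  "optimal_event n \<sigma> \<equiv> {\<omega> \<in> space M. optimal_matching n (\<lambda>i. X i \<omega>) (\<lambda>i. Y i \<omega>) \<sigma>}"

text \<open>Relabelling the pickups by a permutation does not change the joint law, but turns
  the optimality of the identity into that of the permutation.\<close>

lemma prob_optimal_event_eq:
  assumes \<sigma>: "\<sigma> permutes {..<n}"
  shows "prob (optimal_event n \<sigma>) = prob (optimal_event n id)"
proof -
  let ?P = "PiM UNIV (\<lambda>_. borel) :: (nat + nat \<Rightarrow> 'a) measure"
  define h where "h = map_sum \<sigma> (id :: nat \<Rightarrow> nat)"
  define W where "W k = Z (h k)" for k
  define B where "B = {f \<in> space ?P. optimal_matching n (\<lambda>i. f (Inl i)) (\<lambda>i. f (Inr i)) id}"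
  have "inj h"
    using permutes_inj[OF \<sigma>] by (auto simp: h_def inj_def map_sum_def split: sum.splits)
  then have indW: "indep_vars (\<lambda>_. borel) W UNIV"
    unfolding W_def by (rule indep_vars_reindex_inj[OF indep])
  have [measurable]: "W k \<in> borel_measurable M" for k by (simp add: W_def)
  have "distr M borel (W k) = distr M borel (Z k)" for k
    unfolding W_def Z_distr by (cases k) (simp_all add: h_def)
  \<comment> \<open>Both families are independent with the same marginals, since \<open>h\<close>
    moves pickups only to pickups; so both have the same product law.\<close>
  then have law: "distr M ?P (\<lambda>\<omega> k. W k \<omega>) = distr M ?P (\<lambda>\<omega> k. Z k \<omega>)"
    using indep_vars_iff_distr_eq_PiM[of UNIV W "\<lambda>_. borel"] indW
      indep_vars_iff_distr_eq_PiM[of UNIV Z "\<lambda>_. borel"] indep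
    by (simp add: restrict_UNIV)
  have [measurable]: "(\<lambda>f. matching_cost n (\<lambda>i. f (Inl i)) (\<lambda>i. f (Inr i)) \<rho>) \<in> borel_measurable ?P" for \<rho>
    unfolding matching_cost_def
    by (intro borel_measurable_sum borel_measurable_dist measurable_component_singleton) auto
  have "Measurable.pred ?P (\<lambda>f. optimal_matching n (\<lambda>i. f (Inl i)) (\<lambda>i. f (Inr i)) id)"
    unfolding optimal_matching_def
    by (intro pred_intros_logic pred_intros_finite finite_permutations)
      (auto simp: pred_def intro!: borel_measurable_le)
  then have B: "B \<in> sets ?P" by (simp add: B_def pred_def)
  have WP: "(\<lambda>\<omega> k. W k \<omega>) \<in> measurable M ?P" and ZP: "(\<lambda>\<omega> k. Z k \<omega>) \<in> measurable M ?P"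
    by (rule measurable_abs_UNIV, simp)+
  \<comment> \<open>On relabelled pickups the matching \<rho> costs what
    \<open>\<sigma> \<circ> \<rho>\<close> costs on the original ones. As \<rho> runs over all
    permutations so does \<open>\<sigma> \<circ> \<rho>\<close>, and the identity corresponds to
    \<sigma>.\<close>
  have *: "matching_cost n (\<lambda>i. X (\<sigma> i) \<omega>) y \<rho> = matching_cost n (\<lambda>i. X i \<omega>) y (\<sigma> \<circ> \<rho>)" for \<omega> y \<rho>
    by (simp add: matching_cost_def)
  have img: "{\<rho>. \<rho> permutes {..<n}} = (\<circ>) \<sigma> ` {\<rho>. \<rho> permutes {..<n}}"
    using image_compose_permutations_left[OF \<sigma>] by (simp add: setcompr_eq_image)
  have shift: "(\<forall>\<rho>\<in>{\<rho>. \<rho> permutes {..<n}}. Q \<rho>) \<longleftrightarrow> (\<forall>\<rho>\<in>{\<rho>. \<rho> permutes {..<n}}. Q (\<sigma> \<circ> \<rho>))" for Q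
  proof -
    have "(\<forall>\<rho>\<in>{\<rho>. \<rho> permutes {..<n}}. Q \<rho>) \<longleftrightarrow> (\<forall>\<rho>\<in>(\<circ>) \<sigma> ` {\<rho>. \<rho> permutes {..<n}}. Q \<rho>)"
      by (rule ball_cong[OF img refl])
    also have "\<dots> \<longleftrightarrow> (\<forall>\<rho>\<in>{\<rho>. \<rho> permutes {..<n}}. Q (\<sigma> \<circ> \<rho>))"
      by (rule Set.ball_simps(9))
    finally show ?thesis .
  qed
  have "optimal_matching n (\<lambda>i. X (\<sigma> i) \<omega>) y id \<longleftrightarrow> optimal_matching n (\<lambda>i. X i \<omega>) y \<sigma>" for \<omega> y
  proof -
    let ?c = "matching_cost n (\<lambda>i. X i \<omega>) y"
    have "optimal_matching n (\<lambda>i. X (\<sigma> i) \<omega>) y id \<longleftrightarrow>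
        (\<forall>\<rho>\<in>{\<rho>. \<rho> permutes {..<n}}. ?c (\<sigma> \<circ> id) \<le> ?c (\<sigma> \<circ> \<rho>))"
      by (simp only: optimal_matching_def * permutes_id simp_thms)
    also have "\<dots> \<longleftrightarrow> (\<forall>\<rho>\<in>{\<rho>. \<rho> permutes {..<n}}. ?c \<sigma> \<le> ?c \<rho>)"
      unfolding comp_id by (rule shift[symmetric])
    also have "\<dots> \<longleftrightarrow> optimal_matching n (\<lambda>i. X i \<omega>) y \<sigma>"
      using \<sigma> by (simp only: optimal_matching_def simp_thms)
    finally show ?thesis .
  qed
  then have "optimal_event n \<sigma> = (\<lambda>\<omega> k. W k \<omega>) -` B \<inter> space M"
    by (auto simp: B_def W_def h_def space_PiM)
  also have "prob \<dots> = measure (distr M ?P (\<lambda>\<omega> k. W k \<omega>)) B"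
    by (rule measure_distr[OF WP B, symmetric])
  also have "\<dots> = prob ((\<lambda>\<omega> k. Z k \<omega>) -` B \<inter> space M)"
    unfolding law by (rule measure_distr[OF ZP B])
  also have "(\<lambda>\<omega> k. Z k \<omega>) -` B \<inter> space M = optimal_event n id"
    by (auto simp: B_def space_PiM)
  finally show ?thesis .
qed

text \<open>Almost sure uniqueness means that at most one of the n! optimality events occurs, so
  their probabilities sum to at most 1; by exchangeability they are all equal.\<close>

lemma prob_optimal_event_le:
  assumes dim: "2 \<le> DIM('a)" and \<sigma>: "\<sigma> permutes {..<n}"
  shows "prob (optimal_event n \<sigma>) \<le> 1 / fact n"
proof -
  let ?S = "{\<sigma>. \<sigma> permutes {..<n}}"
  have fin: "finite ?S" by (rule finite_permutations) simp
  have "AE \<omega> in M. \<forall>p\<in>{p\<in>?S \<times> ?S. fst p \<noteq> snd p}.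
      matching_cost n (\<lambda>i. X i \<omega>) (\<lambda>i. Y i \<omega>) (fst p) \<noteq> matching_cost n (\<lambda>i. X i \<omega>) (\<lambda>i. Y i \<omega>) (snd p)"
    using fin by (intro AE_finite_allI) (auto intro!: AE_matching_cost_neq[OF dim])
  then have uniq: "AE \<omega> in M. (\<Sum>\<rho>\<in>?S. indicator (optimal_event n \<rho>) \<omega>) \<le> (1::real)"
  proof eventually_elim
    case (elim \<omega>)
    show ?case
    proof (cases "\<exists>\<rho>. \<omega> \<in> optimal_event n \<rho>")
      case True
      then obtain \<rho> where \<rho>: "\<omega> \<in> optimal_event n \<rho>" by blast
      have eq: "\<rho>' = \<rho>" if "\<omega> \<in> optimal_event n \<rho>'" for \<rho>'
      proof (rule ccontr)
        assume "\<rho>' \<noteq> \<rho>"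
        then have "matching_cost n (\<lambda>i. X i \<omega>) (\<lambda>i. Y i \<omega>) \<rho>' \<noteq> matching_cost n (\<lambda>i. X i \<omega>) (\<lambda>i. Y i \<omega>) \<rho>"
          using elim[rule_format, of "(\<rho>', \<rho>)"] \<rho> that by (auto simp: optimal_matching_def)
        moreover have "matching_cost n (\<lambda>i. X i \<omega>) (\<lambda>i. Y i \<omega>) \<rho>' = matching_cost n (\<lambda>i. X i \<omega>) (\<lambda>i. Y i \<omega>) \<rho>"
          using \<rho> that by (intro antisym) (auto simp: optimal_matching_def)
        ultimately show False by simp
      qed
      have "(\<Sum>\<rho>'\<in>?S. indicator (optimal_event n \<rho>') \<omega>) = (\<Sum>\<rho>'\<in>?S. if \<rho>' = \<rho> then 1 else (0::real))"
        using eq \<rho> by (intro sum.cong refl) (auto simp: indicator_def)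
      then show ?thesis using fin by simp
    next
      case False
      then have "(\<Sum>\<rho>\<in>?S. indicator (optimal_event n \<rho>) \<omega>) = (\<Sum>\<rho>\<in>?S. 0::real)"
        by (intro sum.cong refl) (auto simp: indicator_def)
      then show ?thesis by simp
    qed
  qed
  have "fact n * prob (optimal_event n \<sigma>) = (\<Sum>\<rho>\<in>?S. prob (optimal_event n \<sigma>))"
    by (simp only: sum_constant card_permutations[of "{..<n}" n, OF _ finite_lessThan] card_lessThan of_nat_fact)
  also have "\<dots> = (\<Sum>\<rho>\<in>?S. prob (optimal_event n \<rho>))"
  proof (rule sum.cong[OF refl])
    fix \<rho> assume "\<rho> \<in> ?S"
    then show "prob (optimal_event n \<sigma>) = prob (optimal_event n \<rho>)"
      using prob_optimal_event_eq[of \<rho> n] prob_optimal_event_eq[OF \<sigma>] by simp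
  qed
  also have "\<dots> = (\<Sum>\<rho>\<in>?S. expectation (indicator (optimal_event n \<rho>)))"
    by (intro sum.cong refl) (simp add: Int_absorb1 Collect_restrict)
  also have "\<dots> = expectation (\<lambda>\<omega>. \<Sum>\<rho>\<in>?S. indicator (optimal_event n \<rho>) \<omega>)"
    by (rule Bochner_Integration.integral_sum[symmetric])
      (simp add: integrable_indicator_iff emeasure_eq_measure)
  also have "\<dots> \<le> expectation (\<lambda>\<omega>. 1)"
    by (rule integral_mono_AE[OF _ _ uniq]) (auto intro!: Bochner_Integration.integrable_sum simp: integrable_indicator_iff emeasure_eq_measure)
  also have "\<dots> = 1" by (simp add: prob_space)
  finally show ?thesis by (simp add: field_simps)
qed

text \<open>Quantifying over all optimal matchings makes the bad event a finite union of measurable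
  events, and covers whichever one SPLICE selects.\<close>

lemma AE_num_cycles_bound:
  assumes dim: "2 \<le> DIM('a)"
  shows "AE \<omega> in M. \<forall>\<^sub>F n in sequentially. \<forall>\<sigma>.
    optimal_matching n (\<lambda>i. X i \<omega>) (\<lambda>i. Y i \<omega>) \<sigma> \<longrightarrow> 2 ^ num_cycles n \<sigma> < Suc n ^ 3"
proof -
  let ?S = "\<lambda>n. {\<sigma>. \<sigma> permutes {..<n}}"
  let ?T = "\<lambda>n. {\<sigma> \<in> ?S n. Suc n ^ 3 \<le> 2 ^ num_cycles n \<sigma>}"
  define A where "A n = (\<Union>\<sigma>\<in>?T n. optimal_event n \<sigma>)" for n
  have fin: "finite (?S n)" "finite (?T n)" for n by (simp_all add: finite_permutations)
  have A: "A n \<in> sets M" for n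
    unfolding A_def using fin(2) by (intro sets.finite_UN) auto
  have bound: "prob (A n) \<le> inverse (real (Suc n) ^ 2)" for n
  proof -
    have "prob (A n) \<le> (\<Sum>\<sigma>\<in>?T n. prob (optimal_event n \<sigma>))"
      unfolding A_def using fin(2) by (intro finite_measure_subadditive_finite) auto
    \<comment> \<open>Markov's inequality in finite form: on \<open>?T n\<close> the inserted factor
      is at least 1, and afterwards the sum is extended to all permutations.\<close>
    also have "\<dots> \<le> (\<Sum>\<sigma>\<in>?T n. (2 ^ num_cycles n \<sigma> / real (Suc n) ^ 3) * (1 / fact n))"
    proof (rule sum_mono)
      fix \<sigma> assume s: "\<sigma> \<in> ?T n"
      then have "real (Suc n ^ 3) \<le> real (2 ^ num_cycles n \<sigma>)" using of_nat_mono by blast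
      then have "1 \<le> 2 ^ num_cycles n \<sigma> / real (Suc n) ^ 3" by (simp add: field_simps)
      then have "1 * (1 / fact n) \<le> (2 ^ num_cycles n \<sigma> / real (Suc n) ^ 3) * (1 / fact n)"
        by (intro mult_right_mono) auto
      then show "prob (optimal_event n \<sigma>) \<le> (2 ^ num_cycles n \<sigma> / real (Suc n) ^ 3) * (1 / fact n)"
        using prob_optimal_event_le[OF dim, of \<sigma> n] s by simp
    qed
    also have "\<dots> \<le> (\<Sum>\<sigma>\<in>?S n. (2 ^ num_cycles n \<sigma> / real (Suc n) ^ 3) * (1 / fact n))"
      using fin by (intro sum_mono2) auto
    also have "\<dots> = real (\<Sum>\<sigma>\<in>?S n. 2 ^ num_cycles n \<sigma>) / (real (Suc n) ^ 3 * fact n)"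
      by (simp add: sum_divide_distrib)
    also have "\<dots> \<le> real (fact (Suc n)) / (real (Suc n) ^ 3 * fact n)"
      using sum_two_power_num_cycles_le[of n] by (intro divide_right_mono of_nat_mono) auto
    also have "\<dots> = inverse (real (Suc n) ^ 2)"
      by (simp add: divide_simps power2_eq_square power3_eq_cube) (simp add: algebra_simps)
    finally show ?thesis .
  qed
  have "summable (\<lambda>n. prob (A n))"
  proof (rule summable_comparison_test')
    show "summable (\<lambda>n. inverse (real (Suc n) ^ 2))"
      using inverse_power_summable[of 2, where 'a = real] by (subst summable_Suc_iff) simp
    show "norm (prob (A n)) \<le> inverse (real (Suc n) ^ 2)" if "0 \<le> n" for n
      using bound by simp
  qed
  then have "AE \<omega> in M. \<forall>\<^sub>F n in sequentially. \<omega> \<in> space M - A n"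
    by (intro borel_cantelli_AE1 A) (simp_all add: emeasure_eq_measure)
  then show ?thesis
  proof eventually_elim
    case (elim \<omega>)
    then show ?case
      by eventually_elim (force simp: A_def optimal_matching_def)
  qed
qed

section \<open>Linear growth of the total distance from pickups to deliveries\<close>

lemma dist_distr_eq: "distr M borel (\<lambda>\<omega>. dist (X i \<omega>) (Y i \<omega>)) = distr M borel (\<lambda>\<omega>. dist (X 0 \<omega>) (Y 0 \<omega>))"
proof -
  have law: "distr M borel (\<lambda>\<omega>. dist (X i \<omega>) (Y i \<omega>)) =
      distr (density lborel fD \<Otimes>\<^sub>M density lborel fP) borel (\<lambda>(y, x). dist x y)" for i
  proof -
    have "indep_var borel ((\<lambda>r. r (Inr i)) \<circ> (\<lambda>\<omega>. restrict (\<lambda>k. Z k \<omega>) {Inr i}))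
        borel ((\<lambda>r. r (Inl i)) \<circ> (\<lambda>\<omega>. restrict (\<lambda>k. Z k \<omega>) {Inl i}))"
      by (rule indep_var_compose[OF indep_var_restrict[OF indep]]) auto
    then have "indep_var borel (Y i) borel (X i)" by (simp add: comp_def)
    then have joint: "distr M borel (Y i) \<Otimes>\<^sub>M distr M borel (X i) =
        distr M (borel \<Otimes>\<^sub>M borel) (\<lambda>\<omega>. (Y i \<omega>, X i \<omega>))"
      by (simp add: indep_var_distribution_eq)
    have "distr M borel (\<lambda>\<omega>. dist (X i \<omega>) (Y i \<omega>)) =
        distr (distr M (borel \<Otimes>\<^sub>M borel) (\<lambda>\<omega>. (Y i \<omega>, X i \<omega>))) borel (\<lambda>(y, x). dist x y)"
      by (subst distr_distr) (auto simp: comp_def)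
    then show ?thesis
      unfolding joint[symmetric] using Z_distr[of "Inl i"] Z_distr[of "Inr i"] by simp
  qed
  show ?thesis unfolding law ..
qed

text \<open>The distances are bounded, independent and of equal positive mean \<mu>. The constant is
  \<mu> / 2: by Hoeffding, falling to half the expected sum has exponentially small
  probability.\<close>

lemma AE_sum_dist_linear:
  assumes D: "\<And>i \<omega>. \<omega> \<in> space M \<Longrightarrow> dist (X i \<omega>) (Y i \<omega>) \<le> D"
  shows "\<exists>c>0. AE \<omega> in M. \<forall>\<^sub>F n in sequentially. c * real n \<le> (\<Sum>i<n. dist (X i \<omega>) (Y i \<omega>))"
proof -
  define U where "U i \<omega> = dist (X i \<omega>) (Y i \<omega>)" for i \<omega>
  \<comment> \<open>The maximum with 1 ensures a positive range for the variables in Hoeffding's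
    inequality.\<close>
  define E where "E = max D 1"
  have [measurable]: "U i \<in> borel_measurable M" for i unfolding U_def by measurable
  have U: "0 \<le> U i \<omega>" "\<omega> \<in> space M \<Longrightarrow> U i \<omega> \<le> E" for i \<omega>
    using D by (auto simp: U_def E_def le_max_iff_disj)
  have int: "integrable M (U i)" for i
    by (rule integrable_const_bound[where B = E]) (use U in auto)
  have expU: "expectation (U i) = expectation (U 0)" for i
  proof -
    have "expectation (U i) = (\<integral>u. u \<partial>distr M borel (U i))" for i
      by (subst integral_distr) auto
    then show ?thesis unfolding U_def by (simp add: dist_distr_eq[of i])
  qed
  define \<mu> where "\<mu> = expectation (U 0)"
  have "\<mu> > 0"
  proof (rule ccontr)
    assume "\<not> \<mu> > 0"
    then have "\<mu> = 0" unfolding \<mu>_def using U by (simp add: antisym integral_nonneg)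
    then have "AE \<omega> in M. U 0 \<omega> = 0"
      unfolding \<mu>_def using integral_nonneg_eq_0_iff_AE[OF int] U by simp
    moreover have "AE \<omega> in M. U 0 \<omega> \<noteq> 0"
      using AE_Z_neq[of "Inl 0" "Inr 0"] by (simp add: U_def)
    ultimately have "AE \<omega> in M. False" by eventually_elim simp
    then show False by simp
  qed
  \<comment> \<open>The distances inherit independence because the i-th one depends only on the
    block of the i-th pair, and these blocks are disjoint.\<close>
  have "indep_vars (\<lambda>i. PiM {Inl i, Inr i} (\<lambda>_. borel))
      (\<lambda>i \<omega>. restrict (\<lambda>k. Z k \<omega>) {Inl i, Inr i}) UNIV"
    by (intro indep_vars_restrict[OF indep]) (auto simp: disjoint_family_on_def)
  then have "indep_vars (\<lambda>_. borel)
      (\<lambda>i \<omega>. (\<lambda>r. dist (r (Inl i)) (r (Inr i))) (restrict (\<lambda>k. Z k \<omega>) {Inl i, Inr i})) UNIV"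
    by (rule indep_vars_compose2[where Y = "\<lambda>i r. dist (r (Inl i)) (r (Inr i))"]) measurable
  then have indU: "indep_vars (\<lambda>_. borel) U UNIV" by (simp add: U_def[abs_def])
  define A where "A n = {\<omega> \<in> space M. (\<Sum>i<n. U i \<omega>) \<le> real n * \<mu> - real n * \<mu> / 2}" for n
  have [measurable]: "A n \<in> sets M" for n unfolding A_def by measurable
  define q where "q = exp (- (\<mu>\<^sup>2 / (2 * E\<^sup>2)))"
  have "E > 0" by (simp add: E_def)
  have bound: "prob (A n) \<le> q ^ n" for n
  \<comment> \<open>For \<open>n = 0\<close> the bound reads \<open>prob (A 0) \<le> 1\<close>;
    otherwise the sum of squared ranges, n E^2, is positive and the deviation n \<mu> / 2 yields the
    exponent -n \<mu>^2 / (2 E^2).\<close>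
  proof (cases "n = 0")
    case False
    interpret Hoeffding_ineq M "{..<n}" U "\<lambda>_. 0" "\<lambda>_. E" "real n * \<mu>"
    proof unfold_locales
      show "indep_vars (\<lambda>_. borel) U {..<n}" by (rule indep_vars_subset[OF indU]) simp
      show "AE x in M. U i x \<in> {0..E}" for i using U by auto
      have "real n * \<mu> = (\<Sum>i<n. expectation (U i))"
        unfolding \<mu>_def by (subst sum.cong[OF refl expU]) simp
      then show "real n * \<mu> \<equiv> \<Sum>i<n. expectation (U i)" by (rule eq_reflection)
    qed simp
    have "prob (A n) \<le> exp (- 2 * (real n * \<mu> / 2)\<^sup>2 / (\<Sum>i<n. (E - 0)\<^sup>2))"
      unfolding A_def using \<open>\<mu> > 0\<close> False \<open>E > 0\<close> by (intro Hoeffding_ineq_le) auto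
    also have "- 2 * (real n * \<mu> / 2)\<^sup>2 / (\<Sum>i<n. (E - 0)\<^sup>2) = real n * (- (\<mu>\<^sup>2 / (2 * E\<^sup>2)))"
      using False \<open>E > 0\<close> by (simp add: field_simps power2_eq_square)
    also have "exp \<dots> = q ^ n" by (simp only: q_def exp_of_nat_mult)
    finally show ?thesis .
  qed simp
  have "summable (\<lambda>n. prob (A n))"
  proof (rule summable_comparison_test')
    show "summable (\<lambda>n. q ^ n)"
      by (rule summable_geometric) (use \<open>\<mu> > 0\<close> \<open>E > 0\<close> in \<open>simp add: q_def\<close>)
    show "norm (prob (A n)) \<le> q ^ n" if "0 \<le> n" for n using bound by simp
  qed
  then have "AE \<omega> in M. \<forall>\<^sub>F n in sequentially. \<omega> \<in> space M - A n"
    by (intro borel_cantelli_AE1) (simp_all add: emeasure_eq_measure)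
  then have "AE \<omega> in M. \<forall>\<^sub>F n in sequentially. \<mu> / 2 * real n \<le> (\<Sum>i<n. dist (X i \<omega>) (Y i \<omega>))"
  proof eventually_elim
    case (elim \<omega>)
    then show ?case
      by eventually_elim (auto simp: A_def U_def field_simps)
  qed
  then show ?thesis using \<open>\<mu> > 0\<close> by (intro exI[of _ "\<mu> / 2"]) auto
qed

end

section \<open>Asymptotic optimality\<close>

text \<open>The deterministic part, for one fixed sequence of points: the excess is at most D times
  O(log n), while the optimum is at least c n.\<close>

lemma splice_ratio_tendsto:
  fixes x y :: "nat \<Rightarrow> 'a::metric_space"
  assumes sp: "\<And>n. 0 < n \<Longrightarrow> splice_output n x y (S n)"
    and D: "\<And>i j. dist (y i) (x j) \<le> D"
    and c: "0 < c" "\<forall>\<^sub>F n in sequentially. c * real n \<le> (\<Sum>i<n. dist (x i) (y i))"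
    and cycles: "\<forall>\<^sub>F n in sequentially. \<forall>\<sigma>.
      optimal_matching n x y \<sigma> \<longrightarrow> 2 ^ num_cycles n \<sigma> < Suc n ^ 3"
  shows "(\<lambda>n. sc_length n x y (S n) / sc_opt n x y) \<longlonglongrightarrow> 1"
proof -
  have D0: "0 \<le> D" using D[of 0 0] zero_le_dist order_trans by blast
  let ?u = "\<lambda>n. 1 + 3 * log 2 (real n + 1) * D / (c * real n)"
  have "\<forall>\<^sub>F n in sequentially. 1 \<le> sc_length n x y (S n) / sc_opt n x y \<and>
      sc_length n x y (S n) / sc_opt n x y \<le> ?u n"
    using c(2) cycles eventually_gt_at_top[of 0]
  proof eventually_elim
    case (elim n)
    obtain \<sigma> where s: "optimal_matching n x y \<sigma>"
      "(\<Sum>i<n. dist (x i) (y i)) \<le> sc_opt n x y"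
      "sc_opt n x y \<le> sc_length n x y (S n)"
      "sc_length n x y (S n) \<le> sc_opt n x y + real (num_cycles n \<sigma>) * D"
      using splice_output_bounds[OF sp[OF elim(3)] D] by metis
    have opt: "c * real n \<le> sc_opt n x y" "0 < c * real n" using elim s c by auto
    \<comment> \<open>Taking logarithms to base 2 turns the bound on 2^(number of cycles) into at
      most 3 log (n + 1) cycles.\<close>
    have "real (2 ^ num_cycles n \<sigma>) < real (Suc n ^ 3)" using elim s(1) of_nat_less_iff by blast
    then have "2 powr real (num_cycles n \<sigma>) < (real n + 1) powr 3"
      by (simp add: powr_realpow add.commute)
    then have "log 2 (2 powr real (num_cycles n \<sigma>)) < log 2 ((real n + 1) powr 3)"
      by (subst log_less_cancel_iff) auto
    then have N: "real (num_cycles n \<sigma>) \<le> 3 * log 2 (real n + 1)"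
      by (simp add: log_nat_power)
    have "sc_length n x y (S n) / sc_opt n x y \<le>
        (sc_opt n x y + real (num_cycles n \<sigma>) * D) / sc_opt n x y"
      using s(4) opt by (intro divide_right_mono) auto
    also have "\<dots> = 1 + real (num_cycles n \<sigma>) * D / sc_opt n x y"
      using opt by (simp add: add_divide_distrib)
    also have "\<dots> \<le> ?u n"
      using N D0 opt by (intro add_left_mono frac_le mult_right_mono) auto
    finally show ?case using s(3) opt by simp
  qed
  then have ev: "\<forall>\<^sub>F n in sequentially. 1 \<le> sc_length n x y (S n) / sc_opt n x y"
    "\<forall>\<^sub>F n in sequentially. sc_length n x y (S n) / sc_opt n x y \<le> ?u n"
    by (auto elim: eventually_mono)
  have "?u \<longlonglongrightarrow> 1" using c(1) by real_asymp
  then show ?thesis by (rule tendsto_sandwich[OF ev tendsto_const])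
qed

theorem theorem1:
  fixes M :: "'m measure"
    and \<Omega> :: "(real ^ 'd) set"
    and X Y :: "nat \<Rightarrow> 'm \<Rightarrow> real ^ 'd"
    and fP fD :: "real ^ 'd \<Rightarrow> ennreal"
    and S :: "nat \<Rightarrow> 'm \<Rightarrow> nat \<Rightarrow> nat"
  assumes "prob_space M"
    and "CARD('d) \<ge> 2"
    and "compact \<Omega>"
    and "\<And>i. \<forall>\<omega>\<in>space M. X i \<omega> \<in> \<Omega> \<and> Y i \<omega> \<in> \<Omega>"
    and "\<And>i. distributed M lborel (X i) fP"
    and "\<And>i. distributed M lborel (Y i) fD"
    and "prob_space.indep_vars M (\<lambda>_. borel)
           (\<lambda>k. case k of Inl i \<Rightarrow> X i | Inr i \<Rightarrow> Y i) UNIV"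
    and "\<And>n \<omega>. 0 < n \<Longrightarrow> \<omega> \<in> space M \<Longrightarrow>
           splice_output n (\<lambda>i. X i \<omega>) (\<lambda>i. Y i \<omega>) (S n \<omega>)"
  shows "AE \<omega> in M.
           (\<lambda>n. sc_length n (\<lambda>i. X i \<omega>) (\<lambda>i. Y i \<omega>) (S n \<omega>)
                 / sc_opt n (\<lambda>i. X i \<omega>) (\<lambda>i. Y i \<omega>)) \<longlonglongrightarrow> 1"
proof -
  have pairs: "random_pairs M X Y fP fD"
    by (intro random_pairs.intro random_pairs_axioms.intro assms(1,5,6,7))
  have dim: "2 \<le> DIM(real ^ 'd)" using assms(2) by simp
  obtain D where D: "dist u v \<le> D" if "u \<in> \<Omega>" "v \<in> \<Omega>" for u v
    using compact_imp_bounded[OF assms(3)] by (metis bounded_two_points)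
  have "dist (X i \<omega>) (Y i \<omega>) \<le> D" if "\<omega> \<in> space M" for i \<omega>
    using assms(4) that D by blast
  then obtain c where c: "c > 0"
    "AE \<omega> in M. \<forall>\<^sub>F n in sequentially. c * real n \<le> (\<Sum>i<n. dist (X i \<omega>) (Y i \<omega>))"
    using random_pairs.AE_sum_dist_linear[OF pairs] by blast
  \<comment> \<open>Outside a null set both almost sure bounds hold along the sample path;
    membership in \<open>space M\<close> is carried along because the assumptions on \<Omega> and
    \<open>S\<close> are made only there.\<close>
  from c(2) random_pairs.AE_num_cycles_bound[OF pairs dim] AE_space show ?thesis
  proof eventually_elim
    case (elim \<omega>)
    show ?case
    proof (rule splice_ratio_tendsto[OF _ _ c(1) elim(1,2)])
      show "splice_output n (\<lambda>i. X i \<omega>) (\<lambda>i. Y i \<omega>) (S n \<omega>)" if "0 < n" for n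
        using assms(8) that elim(3) .
      show "dist (Y i \<omega>) (X j \<omega>) \<le> D" for i j
        using assms(4) elim(3) D by blast
    qed
  qed
qed

end
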